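(* Let $\beta\in(0,1)$ and let $S\subseteq\mathbb{N}$ be a $\beta$-polynomially sparse set of squarefree numbers. Then, as $x\to+\infty$, $$\#\{(n,n'): n\in S,\ n'\in S,\ \mathrm{lcm}(n,n')\le x\}\le x^{1-\frac{\beta}{2-\beta}+o(1)}.$$ Furthermore, this is tight: for every $\beta\in(0,1)$ there is a $\beta$-polynomially sparse set $S$ of squarefree numbers for which the exponent cannot be improved, i.e. there is no $\delta>0$ such that $\#\{(n,n')\in S\times S:\mathrm{lcm}(n,n')\le x\}\le x^{1-\frac{\beta}{2-\beta}-\delta+o(1)}$ as $x\to+\infty$.
   Context: $\mathbb{N}$ denotes the positive integers. For $\beta\in(0,1)$, a set $S\subseteq\mathbb{N}$ of squarefree numbers is called $\beta$-polynomially sparse if $\#\{n\le x: n\in S\}\le x^{1-\beta+o(1)}$ as $x\to+\infty$. *)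

theory Defs
  imports Complex_Main "HOL-Library.Landau_Symbols" "HOL-Computational_Algebra.Squarefree"
begin

text \<open>
  The statement \<open>f(x) \<le> x^(c + o(1))\<close> as \<open>x \<rightarrow> \<infinity>\<close>: the error term in the exponent is a function of
  the real variable \<open>x\<close>, and may depend on \<open>f\<close> and \<open>c\<close>.
\<close>

definition le_powr_o1 :: "(real \<Rightarrow> real) \<Rightarrow> real \<Rightarrow> bool" where
  "le_powr_o1 f c \<longleftrightarrow>
     (\<exists>e. e \<in> o[at_top](\<lambda>_. 1) \<and> (\<forall>\<^sub>F x in at_top. f x \<le> x powr (c + e x)))"

definition polynomially_sparse :: "real \<Rightarrow> nat set \<Rightarrow> bool" where
  "polynomially_sparse \<beta> S \<longleftrightarrow>
     (\<forall>n\<in>S. n > 0 \<and> squarefree n) \<and>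
     le_powr_o1 (\<lambda>x. real (card {n \<in> S. real n \<le> x})) (1 - \<beta>)"

text \<open>
  Since \<open>lcm 0 n = 0\<close>, the set of pairs below is finite only because polynomially sparse sets
  do not contain \<open>0\<close>.
\<close>

definition lcm_pair_count :: "nat set \<Rightarrow> real \<Rightarrow> real" where
  "lcm_pair_count S x = real (card {(n, n'). n \<in> S \<and> n' \<in> S \<and> real (lcm n n') \<le> x})"

end

theory Submission
  imports
    Defs
    "HOL-Analysis.Harmonic_Numbers"
    "HOL-Real_Asymp.Real_Asymp"
begin

text \<open>
  \<^emph>\<open>Upper bound.\<close> Let \<open>A(y)\<close> count the elements of \<open>S\<close> up to \<open>y\<close>, so that \<open>A(y) \<le> y^(1 - \<beta> + o(1))\<close>,
  and cut at \<open>N = x^(1 / (2 - \<beta>))\<close>. There are at most \<open>A(N)\<^sup>2\<close> pairs with both members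
  at most \<open>N\<close>. If \<open>n > N\<close>, write \<open>g = gcd n n'\<close> and \<open>n' = g * b\<close>; then \<open>lcm n n' = n * b\<close>, so a
  given \<open>n\<close> admits at most \<open>x / n\<close> values of \<open>b\<close>, while \<open>g\<close> is one of the \<open>n^(o(1))\<close> divisors of the
  squarefree number \<open>n\<close> (\<open>squarefree_card_divisors_le\<close>). This leaves \<open>x^(1 + o(1))\<close> times the sum
  of \<open>1 / n\<close> over \<open>n \<in> S\<close> with \<open>N < n \<le> x\<close>, which sparsity bounds by \<open>N^(- \<beta>) * x^(o(1))\<close>
  (\<open>sum_inverse_sparse_le\<close>). The choice of \<open>N\<close> balances the two contributions: \<open>N^(2 - 2 * \<beta>)\<close>
  and \<open>x * N^(- \<beta>)\<close> are both \<open>x^(1 - \<beta> / (2 - \<beta>))\<close>.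

  \<^emph>\<open>Tightness.\<close> The term \<open>A(N)\<^sup>2\<close> is attained only if most pairs of elements near \<open>N\<close> have a gcd of size at least
  about \<open>N^\<beta>\<close>. This happens when they are all multiples of one prime \<open>q\<close> with \<open>q = N^\<beta>\<close>: the squarefree
  multiples of \<open>q\<close> up to \<open>q^(1 / \<beta>)\<close> are a positive proportion of all multiples
  (\<open>card_squarefree_prime_multiples_ge\<close>), any two of them have lcm at most \<open>N\<^sup>2 / q = N^(2 - \<beta>)\<close>,
  and yet no more than \<open>y^(1 - \<beta>)\<close> of them lie below any \<open>y\<close> (\<open>card_prime_block_le\<close>).
  The union of such blocks over primes that grow at least exponentially is still sparse, because
  only \<open>O(log y)\<close> blocks meet \<open>{..y}\<close>, and each block supplies one scale \<open>x\<close> at which the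
  upper bound is attained up to a constant.
\<close>

section \<open>Exponents up to \<open>o(1)\<close>\<close>

text \<open>
  In the direction from right to left, the error term is the excess of the exponent
  \<open>ln (f x) / ln x\<close> over \<open>c\<close>, truncated at zero since \<open>f\<close> may be much smaller than \<open>x powr c\<close>.
\<close>

lemma le_powr_o1_iff:
  "le_powr_o1 f c \<longleftrightarrow> (\<forall>\<epsilon>>0. \<forall>\<^sub>F x in at_top. f x \<le> x powr (c + \<epsilon>))"
proof
  assume "le_powr_o1 f c"
  then obtain e where e: "e \<in> o[at_top](\<lambda>_. 1)" and le: "\<forall>\<^sub>F x in at_top. f x \<le> x powr (c + e x)"
    unfolding le_powr_o1_def by blast
  show "\<forall>\<epsilon>>0. \<forall>\<^sub>F x in at_top. f x \<le> x powr (c + \<epsilon>)"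
  proof (intro allI impI)
    fix \<epsilon> :: real assume "\<epsilon> > 0"
    from landau_o.smallD[OF e this] le eventually_gt_at_top[of 1]
    show "\<forall>\<^sub>F x in at_top. f x \<le> x powr (c + \<epsilon>)"
    proof eventually_elim
      case (elim x)
      have "x powr (c + e x) \<le> x powr (c + \<epsilon>)"
        using elim by (intro powr_mono) auto
      with elim show ?case by linarith
    qed
  qed
next
  assume *: "\<forall>\<epsilon>>0. \<forall>\<^sub>F x in at_top. f x \<le> x powr (c + \<epsilon>)"
  define e where "e x = (if f x > 0 then max 0 (ln (f x) / ln x - c) else 0)" for x
  have "e \<in> o[at_top](\<lambda>_. 1)"
  proof (rule landau_o.smallI)
    fix \<epsilon> :: real assume "\<epsilon> > 0"
    with * have "\<forall>\<^sub>F x in at_top. f x \<le> x powr (c + \<epsilon>)" by blast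
    with eventually_gt_at_top[of 1] show "\<forall>\<^sub>F x in at_top. norm (e x) \<le> \<epsilon> * norm (1::real)"
    proof eventually_elim
      case (elim x)
      show ?case
      proof (cases "f x > 0")
        case True
        have "ln (f x) \<le> ln (x powr (c + \<epsilon>))"
          using True elim by (subst ln_le_cancel_iff) auto
        also have "\<dots> = (c + \<epsilon>) * ln x" using elim by simp
        finally have "ln (f x) / ln x \<le> c + \<epsilon>" using elim by (simp add: field_simps)
        with True \<open>\<epsilon> > 0\<close> show ?thesis by (simp add: e_def)
      qed (use \<open>\<epsilon> > 0\<close> in \<open>simp add: e_def\<close>)
    qed
  qed
  moreover have "\<forall>\<^sub>F x in at_top. f x \<le> x powr (c + e x)"
    using eventually_gt_at_top[of 1]
  proof eventually_elim
    case (elim x)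
    show ?case
    proof (cases "f x > 0")
      case True
      have "f x = x powr (ln (f x) / ln x)"
        using True elim by (simp add: powr_def)
      also have "\<dots> \<le> x powr (c + e x)"
        using elim True by (intro powr_mono) (auto simp: e_def)
      finally show ?thesis .
    next
      case False
      thus ?thesis using powr_ge_zero[of x "c + e x"] by linarith
    qed
  qed
  ultimately show "le_powr_o1 f c" unfolding le_powr_o1_def by blast
qed

section \<open>The number of divisors of a squarefree number\<close>

lemma card_divisors_prime_mult_le:
  fixes p n :: nat
  assumes "prime p" "n > 0"
  shows "card {d. d dvd p * n} \<le> 2 * card {d. d dvd n}"
proof -
  have "{d. d dvd p * n} \<subseteq> {d. d dvd n} \<union> (*) p ` {d. d dvd n}"
  proof
    fix d assume "d \<in> {d. d dvd p * n}"
    then have d: "d dvd p * n" by simp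
    show "d \<in> {d. d dvd n} \<union> (*) p ` {d. d dvd n}"
    proof (cases "p dvd d")
      case True
      then obtain k where "d = p * k" by blast
      with d assms show ?thesis by (auto simp: prime_gt_0_nat)
    next
      case False
      with assms have "coprime d p" by (metis coprime_commute prime_imp_coprime)
      with d show ?thesis by (simp add: coprime_dvd_mult_right_iff)
    qed
  qed
  then have "card {d. d dvd p * n} \<le> card ({d. d dvd n} \<union> (*) p ` {d. d dvd n})"
    using assms by (intro card_mono) auto
  also have "\<dots> \<le> card {d. d dvd n} + card ((*) p ` {d. d dvd n})" by (rule card_Un_le)
  also have "card ((*) p ` {d. d dvd n}) \<le> card {d. d dvd n}"
    using assms by (intro card_image_le) auto
  finally show ?thesis by simp
qed

text \<open>
  Each prime factor at most doubles the number of divisors. For a prime \<open>p \<ge> 2 powr (1 / \<epsilon>)\<close> the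
  factor 2 is at most \<open>p powr \<epsilon>\<close>, and the finitely many smaller primes occur at most once each,
  so together they cost only a constant.
\<close>
lemma squarefree_card_divisors_le:
  fixes \<epsilon> :: real
  assumes "\<epsilon> > 0"
  obtains C where "C > 0"
    and "\<And>n::nat. squarefree n \<Longrightarrow> real (card {d. d dvd n}) \<le> C * real n powr \<epsilon>"
proof -
  define P where "P = nat \<lceil>2 powr (1 / \<epsilon>)\<rceil>"
  define small where "small n = {p::nat. prime p \<and> p dvd n \<and> p \<le> P}" for n
  have fin: "finite (small n)" for n
    by (rule finite_subset[of _ "{..P}"]) (auto simp: small_def)
  have large: "2 \<le> real p powr \<epsilon>" if "p > P" for p
  proof -
    have "2 = (2 powr (1 / \<epsilon>)) powr \<epsilon>" using assms by (simp add: powr_powr)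
    also have "2 powr (1 / \<epsilon>) \<le> real p" using that unfolding P_def by linarith
    hence "(2 powr (1 / \<epsilon>)) powr \<epsilon> \<le> real p powr \<epsilon>" using assms by (intro powr_mono2) auto
    finally show ?thesis .
  qed
  have main: "squarefree n \<Longrightarrow> real (card {d. d dvd n}) \<le> 2 ^ card (small n) * real n powr \<epsilon>" for n
  proof (induction n rule: prime_divisors_induct)
    case (unit n)
    then have "{d. d dvd n} = {1}" "small n = {}" "n = 1"
      by (auto simp: small_def)
    thus ?case by simp
  next
    case (factor p n)
    have n: "squarefree n" "n > 0" "\<not> p dvd n"
    proof -
      show "squarefree n" using factor.prems squarefree_multD by blast
      show "n > 0" using factor.prems by (cases "n = 0") auto
      show "\<not> p dvd n"
      proof
        assume "p dvd n"
        then have "p ^ 2 dvd p * n" by (simp add: power2_eq_square)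
        with factor.prems have "is_unit p" by (auto simp: squarefree_def)
        with factor.hyps show False by auto
      qed
    qed
    have pos: "real p powr \<epsilon> \<ge> 1"
      using prime_ge_1_nat[OF factor.hyps] assms by (intro ge_one_powr_ge_zero) auto
    have mono: "card (small n) \<le> card (small (p * n))"
      using fin by (intro card_mono) (auto simp: small_def)
    have step: "2 * 2 ^ card (small n) \<le> 2 ^ card (small (p * n)) * real p powr \<epsilon>"
    proof (cases "p > P")
      case True
      have "(2::real) ^ card (small n) \<le> 2 ^ card (small (p * n))"
        using mono by (intro power_increasing) auto
      from mult_mono[OF this large[OF True]] show ?thesis by (simp add: mult_ac)
    next
      case False
      have "insert p (small n) \<subseteq> small (p * n)"
        using False factor.hyps by (auto simp: small_def)
      then have "card (insert p (small n)) \<le> card (small (p * n))"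
        using fin by (intro card_mono) auto
      moreover have "p \<notin> small n" using n by (simp add: small_def)
      ultimately have "Suc (card (small n)) \<le> card (small (p * n))" using fin by simp
      then have "(2::real) ^ Suc (card (small n)) \<le> 2 ^ card (small (p * n))"
        by (intro power_increasing) auto
      from mult_mono[OF this pos] show ?thesis by simp
    qed
    have "real (card {d. d dvd p * n}) \<le> 2 * real (card {d. d dvd n})"
      using card_divisors_prime_mult_le[OF factor.hyps n(2)] by linarith
    also have "\<dots> \<le> (2 * 2 ^ card (small n)) * real n powr \<epsilon>"
      using factor.IH[OF n(1)] by simp
    also have "\<dots> \<le> (2 ^ card (small (p * n)) * real p powr \<epsilon>) * real n powr \<epsilon>"
      using step by (intro mult_right_mono) auto
    also have "\<dots> = 2 ^ card (small (p * n)) * real (p * n) powr \<epsilon>"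
      by (simp add: powr_mult)
    finally show ?case .
  qed auto
  show ?thesis
  proof (rule that[of "2 ^ Suc P"])
    fix n :: nat assume "squarefree n"
    have "card (small n) \<le> card {..P}" by (intro card_mono) (auto simp: small_def)
    then have "(2::real) ^ card (small n) \<le> 2 ^ Suc P" by (intro power_increasing) auto
    then have "2 ^ card (small n) * real n powr \<epsilon> \<le> 2 ^ Suc P * real n powr \<epsilon>"
      by (intro mult_right_mono) auto
    with main[OF \<open>squarefree n\<close>]
    show "real (card {d. d dvd n}) \<le> 2 ^ Suc P * real n powr \<epsilon>" by (rule order_trans)
  qed simp
qed

section \<open>Reciprocal sums over sparse sets\<close>

lemma sum_inverse_rank_eq_harm:
  fixes T :: "'a :: linorder set"
  assumes "finite T"
  shows "(\<Sum>n\<in>T. 1 / real (card {m \<in> T. m \<le> n})) = harm (card T)"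
  using assms
proof (induction T rule: finite_linorder_max_induct)
  case empty
  then show ?case by (simp add: harm_def)
next
  case (insert b A)
  have "{m \<in> insert b A. m \<le> n} = {m \<in> A. m \<le> n}" if "n \<in> A" for n
    using insert.hyps that by force
  moreover have "{m \<in> insert b A. m \<le> b} = insert b A" using insert.hyps by force
  moreover have "b \<notin> A" using insert.hyps by auto
  ultimately show ?case using insert by (simp add: harm_Suc inverse_eq_divide)
qed

lemma harm_le_1_plus_ln:
  assumes "n > 0"
  shows "harm n \<le> 1 + ln (real n)"
  using euler_mascheroni_sequence_decreasing[of 1 n] assms by (simp add: harm_def)

text \<open>
  This replaces partial summation. Sparsity says that the rank of \<open>n\<close> in \<open>T\<close> is at most
  \<open>n powr \<alpha>\<close>, hence \<open>1 / n = n powr (\<alpha> - 1) * n powr (- \<alpha>)\<close> is at most \<open>N powr (\<alpha> - 1)\<close> divided by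
  that rank. The ranks are exactly \<open>1, ..., card T\<close>, so their reciprocals add up to a harmonic number.
\<close>
lemma sum_inverse_sparse_le:
  fixes T :: "nat set" and N x \<alpha> :: real
  assumes "finite T" "0 < N" "1 \<le> x" "\<alpha> \<le> 1"
    and range: "\<And>n. n \<in> T \<Longrightarrow> N < real n \<and> real n \<le> x"
    and sparse: "\<And>n. n \<in> T \<Longrightarrow> real (card {m \<in> T. m \<le> n}) \<le> real n powr \<alpha>"
  shows "(\<Sum>n\<in>T. 1 / real n) \<le> N powr (\<alpha> - 1) * (1 + ln x)"
proof (cases "T = {}")
  case True
  then show ?thesis using assms by simp
next
  case False
  have summand: "1 / real n \<le> N powr (\<alpha> - 1) * (1 / real (card {m \<in> T. m \<le> n}))" if "n \<in> T" for n
  proof -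
    have n: "real n > 0" using range[OF that] \<open>0 < N\<close> by simp
    have "card {m \<in> T. m \<le> n} > 0" using that \<open>finite T\<close> by (auto simp: card_gt_0_iff)
    then have "1 / real n powr \<alpha> \<le> 1 / real (card {m \<in> T. m \<le> n})"
      using sparse[OF that] n by (intro divide_left_mono) auto
    moreover have "real n powr (\<alpha> - 1) \<le> N powr (\<alpha> - 1)"
      using range[OF that] assms by (intro powr_mono2') auto
    ultimately have "real n powr (\<alpha> - 1) * (1 / real n powr \<alpha>)
        \<le> N powr (\<alpha> - 1) * (1 / real (card {m \<in> T. m \<le> n}))"
      by (intro mult_mono) auto
    also have "real n powr (\<alpha> - 1) * (1 / real n powr \<alpha>) = 1 / real n"
      using n by (simp add: powr_diff)
    finally show ?thesis .
  qed
  have "card T \<le> card {1..nat \<lfloor>x\<rfloor>}"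
    using range \<open>0 < N\<close> by (intro card_mono) (force simp: le_nat_floor)+
  then have card_T: "real (card T) \<le> x" using \<open>1 \<le> x\<close> by simp linarith
  have pos: "card T > 0" using False \<open>finite T\<close> by (simp add: card_gt_0_iff)
  have "(\<Sum>n\<in>T. 1 / real n) \<le> N powr (\<alpha> - 1) * (\<Sum>n\<in>T. 1 / real (card {m \<in> T. m \<le> n}))"
    unfolding sum_distrib_left by (intro sum_mono summand)
  also have "\<dots> = N powr (\<alpha> - 1) * harm (card T)"
    using sum_inverse_rank_eq_harm[OF \<open>finite T\<close>] by simp
  also have "\<dots> \<le> N powr (\<alpha> - 1) * (1 + ln x)"
  proof (intro mult_left_mono)
    have "harm (card T) \<le> 1 + ln (real (card T))" using pos by (rule harm_le_1_plus_ln)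
    also have "\<dots> \<le> 1 + ln x" using pos card_T by simp
    finally show "harm (card T) \<le> 1 + ln x" .
  qed simp
  finally show ?thesis .
qed

section \<open>The upper bound\<close>

text \<open>
  A pair \<open>(n, n')\<close> is determined by \<open>n\<close>, the divisor \<open>g = gcd n n'\<close> of \<open>n\<close>, and the cofactor
  \<open>b = n' div g\<close>, which is at most \<open>x / n\<close> because \<open>lcm n n' = n * b\<close>.
\<close>
lemma card_lcm_pairs_fst_le:
  fixes S T :: "nat set" and x :: real
  assumes "finite T" "0 \<notin> T" "0 \<notin> S" "x \<ge> 0"
  shows "real (card {(n, n'). n \<in> T \<and> n' \<in> S \<and> real (lcm n n') \<le> x})
    \<le> (\<Sum>n\<in>T. real (card {d. d dvd n}) * (x / real n))"
proof -
  let ?P = "{(n, n'). n \<in> T \<and> n' \<in> S \<and> real (lcm n n') \<le> x}"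
  define D where "D = (SIGMA n:T. {d. d dvd n} \<times> {1..nat \<lfloor>x / real n\<rfloor>})"
  have finD: "finite D" unfolding D_def
    using assms by (intro finite_SigmaI finite_cartesian_product finite_divisors_nat) (auto intro!: Nat.gr0I)
  have "?P \<subseteq> (\<lambda>(n, g, b). (n, g * b)) ` D"
  proof (clarify)
    fix n n' assume *: "n \<in> T" "n' \<in> S" "real (lcm n n') \<le> x"
    define g where "g = gcd n n'"
    define b where "b = n' div g"
    have pos: "n > 0" "n' > 0" using * assms by (auto intro!: Nat.gr0I)
    have n': "n' = g * b" by (simp add: g_def b_def)
    have "g > 0" using pos by (simp add: g_def)
    have "n * n' = g * lcm n n'" unfolding g_def by (rule prod_gcd_lcm_nat)
    moreover have "n * n' = g * (n * b)" by (subst n') (simp add: mult_ac)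
    ultimately have "lcm n n' = n * b" using \<open>g > 0\<close> by simp
    then have "real b \<le> x / real n" using * pos by (simp add: field_simps)
    moreover have "b > 0" using n' pos by (auto intro!: Nat.gr0I)
    ultimately have "b \<in> {1..nat \<lfloor>x / real n\<rfloor>}" by (simp add: le_nat_floor Suc_le_eq)
    moreover have "g dvd n" by (simp add: g_def)
    ultimately show "(n, n') \<in> (\<lambda>(n, g, b). (n, g * b)) ` D"
      using * n' by (auto simp: D_def intro!: image_eqI[of _ _ "(n, g, b)"])
  qed
  then have "card ?P \<le> card D" using finD by (meson card_image_le card_mono finite_imageI le_trans)
  also have "card D = (\<Sum>n\<in>T. card {d. d dvd n} * nat \<lfloor>x / real n\<rfloor>)"
    unfolding D_def using assms
    by (subst card_SigmaI)
      (auto simp: card_cartesian_product intro!: Nat.gr0I finite_cartesian_product finite_divisors_nat)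
  finally have "real (card ?P) \<le> (\<Sum>n\<in>T. real (card {d. d dvd n}) * real (nat \<lfloor>x / real n\<rfloor>))"
    by (simp flip: of_nat_mult of_nat_sum)
  also have "\<dots> \<le> (\<Sum>n\<in>T. real (card {d. d dvd n}) * (x / real n))"
    using assms by (intro sum_mono mult_left_mono of_nat_floor) auto
  finally show ?thesis .
qed

lemma finite_lcm_pairs:
  fixes S :: "nat set"
  assumes "0 \<notin> S"
  shows "finite {(n, n'). n \<in> S \<and> n' \<in> S \<and> real (lcm n n') \<le> x}"
proof (rule finite_subset)
  show "{(n, n'). n \<in> S \<and> n' \<in> S \<and> real (lcm n n') \<le> x} \<subseteq> {..nat \<lfloor>x\<rfloor>} \<times> {..nat \<lfloor>x\<rfloor>}"
  proof clarify
    fix n n' assume *: "n \<in> S" "n' \<in> S" "real (lcm n n') \<le> x"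
    then have "n > 0" "n' > 0" using assms by (auto intro!: Nat.gr0I)
    then have "n \<le> lcm n n'" "n' \<le> lcm n n'" by (auto intro!: dvd_imp_le lcm_pos_nat)
    with * have "real n \<le> x" "real n' \<le> x" by linarith+
    then show "n \<in> {..nat \<lfloor>x\<rfloor>} \<and> n' \<in> {..nat \<lfloor>x\<rfloor>}" by (simp add: le_nat_floor)
  qed
qed simp

lemma lcm_pair_count_upper:
  fixes \<beta> :: real
  assumes \<beta>: "0 < \<beta>" "\<beta> < 1" and S: "polynomially_sparse \<beta> S"
  shows "le_powr_o1 (lcm_pair_count S) (1 - \<beta> / (2 - \<beta>))"
  unfolding le_powr_o1_iff
proof (intro allI impI)
  fix \<epsilon>\<^sub>0 :: real assume "\<epsilon>\<^sub>0 > 0"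
  \<comment> \<open>The divisor bound, the sparsity of \<open>S\<close> and the logarithm each cost a factor of at most
    about \<open>x powr \<epsilon>\<close>;
    \<open>\<epsilon> \<le> \<beta>\<close> keeps the exponent of \<open>N\<close> in the reciprocal sum from being positive.\<close>
  define \<epsilon> where "\<epsilon> = min (\<epsilon>\<^sub>0 / 3) \<beta>"
  have \<epsilon>: "0 < \<epsilon>" "3 * \<epsilon> \<le> \<epsilon>\<^sub>0" "\<epsilon> \<le> \<beta>" using \<open>\<epsilon>\<^sub>0 > 0\<close> \<beta> by (auto simp: \<epsilon>_def)
  define \<gamma> where "\<gamma> = 1 / (2 - \<beta>)"
  define c where "c = 1 - \<beta> / (2 - \<beta>)"
  have \<gamma>: "0 < \<gamma>" "\<gamma> \<le> 1" "2 * \<gamma> * (1 - \<beta>) = c" "1 - \<gamma> * \<beta> = c"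
    using \<beta> by (auto simp: \<gamma>_def c_def field_simps)
  have zero: "0 \<notin> S" and sqf: "\<And>n. n \<in> S \<Longrightarrow> squarefree n"
    using S by (auto simp: polynomially_sparse_def)
  obtain C where C: "C > 0" "\<And>n::nat. squarefree n \<Longrightarrow> real (card {d. d dvd n}) \<le> C * real n powr \<epsilon>"
    using squarefree_card_divisors_le[OF \<epsilon>(1)] by blast
  have "\<forall>\<^sub>F y in at_top. real (card {n \<in> S. real n \<le> y}) \<le> y powr (1 - \<beta> + \<epsilon>)"
    using S \<epsilon>(1) by (auto simp: polynomially_sparse_def le_powr_o1_iff)
  then obtain Y where Y: "\<And>y. y \<ge> Y \<Longrightarrow> real (card {n \<in> S. real n \<le> y}) \<le> y powr (1 - \<beta> + \<epsilon>)"
    by (auto simp: eventually_at_top_linorder)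
  have "\<forall>\<^sub>F x::real in at_top. x powr \<gamma> \<ge> max Y 1"
    using \<gamma>(1) by real_asymp
  moreover have "\<forall>\<^sub>F x::real in at_top. 1 + 2 * C * (1 + ln x) \<le> x powr \<epsilon>"
    using \<epsilon>(1) C(1) by real_asymp
  ultimately show "\<forall>\<^sub>F x in at_top. lcm_pair_count S x \<le> x powr (1 - \<beta> / (2 - \<beta>) + \<epsilon>\<^sub>0)"
    using eventually_ge_at_top[of 1]
  proof eventually_elim
    case (elim x)
    \<comment> \<open>With this threshold, \<open>N powr (2 * (1 - \<beta>))\<close> and \<open>x * N powr (- \<beta>)\<close> both equal \<open>x powr c\<close>.\<close>
    define N where "N = x powr \<gamma>"
    have N: "N \<ge> Y" "N \<ge> 1" using elim by (auto simp: N_def)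
    let ?pairs = "\<lambda>T U. {(n, n'). n \<in> T \<and> n' \<in> U \<and> real (lcm n n') \<le> x}"
    define low where "low = {n \<in> S. real n \<le> N}"
    define high where "high = {n \<in> S. N < real n \<and> real n \<le> x}"
    have fin_high: "finite high" by (rule finite_subset[of _ "{..nat \<lfloor>x\<rfloor>}"]) (auto simp: high_def le_nat_floor)
    have fin_low: "finite low" by (rule finite_subset[of _ "{..nat \<lfloor>N\<rfloor>}"]) (auto simp: low_def le_nat_floor)
    have le_x: "real n \<le> x" if "n \<in> S" "n' \<in> S" "real (lcm n n') \<le> x" for n n'
    proof -
      have "n > 0" "n' > 0" using that zero by (auto intro!: Nat.gr0I)
      then have "n \<le> lcm n n'" by (auto intro!: dvd_imp_le lcm_pos_nat)
      with that show ?thesis by linarith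
    qed
    have cover: "?pairs S S \<subseteq> low \<times> low \<union> ?pairs high S \<union> prod.swap ` ?pairs high S"
    proof
      fix p assume "p \<in> ?pairs S S"
      then obtain n n' where p: "p = (n, n')" "n \<in> S" "n' \<in> S" "real (lcm n n') \<le> x" by auto
      consider "n \<in> high" | "n' \<in> high" | "n \<notin> high" "n' \<notin> high" by blast
      then show "p \<in> low \<times> low \<union> ?pairs high S \<union> prod.swap ` ?pairs high S"
      proof cases
        case 1
        with p show ?thesis by simp
      next
        case 2
        with p have "(n', n) \<in> ?pairs high S" by (simp add: lcm.commute)
        then have "prod.swap (n', n) \<in> prod.swap ` ?pairs high S" by (rule imageI)
        with p show ?thesis by simp
      next
        case 3
        with p le_x[of n n'] le_x[of n' n] show ?thesis
          by (simp add: high_def low_def lcm.commute)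
      qed
    qed
    have fin_pairs: "finite (?pairs high S)"
      by (rule finite_subset[OF _ finite_lcm_pairs[OF zero, of x]]) (auto simp: high_def)
    have "card (?pairs S S) \<le> card (low \<times> low \<union> ?pairs high S \<union> prod.swap ` ?pairs high S)"
      using cover fin_low fin_pairs by (intro card_mono) auto
    also have "\<dots> \<le> card (low \<times> low) + card (?pairs high S) + card (prod.swap ` ?pairs high S)"
      by (meson add_le_mono card_Un_le le_refl le_trans)
    also have "card (prod.swap ` ?pairs high S) \<le> card (?pairs high S)"
      using fin_pairs by (rule card_image_le)
    finally have "real (card (?pairs S S)) \<le> real (card (low \<times> low)) + 2 * real (card (?pairs high S))"
      by linarith
    moreover have "real (card (low \<times> low)) \<le> x powr (c + 2 * \<epsilon>)"
    proof -
      have "real (card low) \<le> N powr (1 - \<beta> + \<epsilon>)" using Y[OF N(1)] by (simp add: low_def)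
      then have "real (card low) * real (card low) \<le> N powr (1 - \<beta> + \<epsilon>) * N powr (1 - \<beta> + \<epsilon>)"
        by (intro mult_mono) auto
      also have "\<dots> = x powr (c + 2 * \<gamma> * \<epsilon>)"
        by (simp add: N_def powr_powr \<gamma>(3)[symmetric] algebra_simps flip: powr_add)
      also have "\<dots> \<le> x powr (c + 2 * \<epsilon>)"
        using elim \<gamma> \<epsilon> by (intro powr_mono) auto
      finally show ?thesis by (simp add: card_cartesian_product)
    qed
    moreover have "real (card (?pairs high S)) \<le> C * (1 + ln x) * x powr (c + 2 * \<epsilon>)"
    proof -
      have reciprocals: "(\<Sum>n\<in>high. 1 / real n) \<le> N powr ((1 - \<beta> + \<epsilon>) - 1) * (1 + ln x)"
      proof (rule sum_inverse_sparse_le[OF fin_high])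
        fix n assume n: "n \<in> high"
        then show "N < real n \<and> real n \<le> x" by (simp add: high_def)
        have "card {m \<in> high. m \<le> n} \<le> card {m \<in> S. real m \<le> real n}"
          by (rule card_mono[OF finite_subset[of _ "{..n}"]]) (auto simp: high_def)
        also have "real \<dots> \<le> real n powr (1 - \<beta> + \<epsilon>)"
          using n N by (intro Y) (auto simp: high_def)
        finally show "real (card {m \<in> high. m \<le> n}) \<le> real n powr (1 - \<beta> + \<epsilon>)" by simp
      qed (use N elim \<epsilon> in auto)
      have "real (card (?pairs high S)) \<le> (\<Sum>n\<in>high. real (card {d. d dvd n}) * (x / real n))"
        using fin_high zero elim by (intro card_lcm_pairs_fst_le) (auto simp: high_def)
      also have "\<dots> \<le> (\<Sum>n\<in>high. (C * x powr \<epsilon>) * (x * (1 / real n)))"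
      proof (intro sum_mono mult_mono)
        fix n assume n: "n \<in> high"
        have "real (card {d. d dvd n}) \<le> C * real n powr \<epsilon>" using n sqf by (intro C) (auto simp: high_def)
        also have "\<dots> \<le> C * x powr \<epsilon>"
          using n C \<epsilon> by (intro mult_left_mono powr_mono2) (auto simp: high_def)
        finally show "real (card {d. d dvd n}) \<le> C * x powr \<epsilon>" .
      qed (use elim C in auto)
      also have "\<dots> = C * x powr (1 + \<epsilon>) * (\<Sum>n\<in>high. 1 / real n)"
        using elim by (simp add: powr_add sum_distrib_left mult_ac)
      also have "\<dots> \<le> C * x powr (1 + \<epsilon>) * (N powr ((1 - \<beta> + \<epsilon>) - 1) * (1 + ln x))"
        using C reciprocals by (intro mult_left_mono) auto
      also have "\<dots> = C * (1 + ln x) * x powr (c + (1 + \<gamma>) * \<epsilon>)"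
        by (simp add: N_def powr_powr \<gamma>(4)[symmetric] algebra_simps flip: powr_add)
      also have "\<dots> \<le> C * (1 + ln x) * x powr (c + 2 * \<epsilon>)"
        using elim C \<gamma> \<epsilon> by (intro mult_left_mono powr_mono) auto
      finally show ?thesis .
    qed
    ultimately have "lcm_pair_count S x \<le> (1 + 2 * C * (1 + ln x)) * x powr (c + 2 * \<epsilon>)"
      unfolding lcm_pair_count_def by (simp add: algebra_simps)
    also have "\<dots> \<le> x powr \<epsilon> * x powr (c + 2 * \<epsilon>)"
      using elim by (intro mult_right_mono) auto
    also have "\<dots> = x powr (c + 3 * \<epsilon>)" by (simp add: add_ac flip: powr_add)
    also have "\<dots> \<le> x powr (c + \<epsilon>\<^sub>0)" using elim \<epsilon> by (intro powr_mono) auto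
    finally show ?case by (simp add: c_def)
  qed
qed

section \<open>Squarefree multiples of a prime\<close>

text \<open>
  If \<open>q * m\<close> is not squarefree then \<open>q\<close> divides \<open>m\<close> or some \<open>d\<^sup>2\<close> with \<open>d \<ge> 2\<close> does. The sum of
  \<open>1 / d\<^sup>2\<close> over \<open>d \<ge> 2\<close> is at most \<open>1 / 4 + (1 / 2 - 1 / 3) + (1 / 3 - 1 / 4) + ... = 3 / 4\<close>, and
  \<open>q \<ge> 8\<close> makes the other case cost at most \<open>1 / 8\<close>, so a proportion of \<open>1 / 8\<close> survives.
\<close>
lemma card_squarefree_prime_multiples_ge:
  fixes q M :: nat
  assumes "prime q" "q \<ge> 8"
  shows "real M / 8 \<le> real (card {m \<in> {1..M}. squarefree (q * m)})"
proof -
  define G where "G = {m \<in> {1..M}. squarefree (q * m)}"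
  define mult where "mult d = {m \<in> {1..M}. d dvd m}" for d
  have card_mult: "real (card (mult d)) \<le> real M / real d" if "d > 0" for d
  proof -
    have "mult d \<subseteq> (*) d ` {1..M div d}"
    proof
      fix m assume "m \<in> mult d"
      then obtain k where "m = d * k" "1 \<le> m" "m \<le> M" by (auto simp: mult_def)
      with that show "m \<in> (*) d ` {1..M div d}"
        by (auto simp: less_eq_div_iff_mult_less_eq mult.commute Suc_le_eq)
    qed
    then have "card (mult d) \<le> card {1..M div d}"
      by (meson card_image_le card_mono finite_atLeastAtMost finite_imageI le_trans)
    then have "real (card (mult d)) \<le> real (M div d)" by simp
    also have "\<dots> \<le> real M / real d" by (rule of_nat_div_le_of_nat)
    finally show ?thesis .
  qed
  have cover: "{1..M} \<subseteq> G \<union> mult q \<union> (\<Union>d\<in>{2..M}. mult (d\<^sup>2))"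
  proof
    fix m assume m: "m \<in> {1..M}"
    show "m \<in> G \<union> mult q \<union> (\<Union>d\<in>{2..M}. mult (d\<^sup>2))"
    proof (cases "q dvd m \<or> squarefree (q * m)")
      case False
      then have "coprime q m" using assms prime_imp_coprime by blast
      moreover have "squarefree q" using assms squarefree_prime by blast
      ultimately have "\<not> squarefree m" using False squarefree_mult_coprime by blast
      then obtain d where d: "d\<^sup>2 dvd m" "d \<noteq> 1" by (auto simp: squarefree_def)
      have "d \<noteq> 0" using d m by (cases "d = 0") auto
      have "d \<le> d\<^sup>2" by (simp add: power2_nat_le_imp_le power2_eq_square)
      also have "d\<^sup>2 \<le> m" using d m by (intro dvd_imp_le) auto
      finally have "d \<in> {2..M}" using m d \<open>d \<noteq> 0\<close> by auto
      with d m show ?thesis by (auto simp: mult_def)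
    qed (use m in \<open>auto simp: G_def mult_def\<close>)
  qed
  have fin: "finite G" "finite (mult d)" for d by (auto simp: G_def mult_def)
  have "M = card {1..M}" by simp
  also have "\<dots> \<le> card (G \<union> mult q \<union> (\<Union>d\<in>{2..M}. mult (d\<^sup>2)))"
    using cover fin by (intro card_mono) auto
  also have "\<dots> \<le> card G + card (mult q) + card (\<Union>d\<in>{2..M}. mult (d\<^sup>2))"
    by (meson add_le_mono card_Un_le le_refl le_trans)
  also have "card (\<Union>d\<in>{2..M}. mult (d\<^sup>2)) \<le> (\<Sum>d=2..M. card (mult (d\<^sup>2)))"
    by (rule card_UN_le) simp
  finally have "real M \<le> real (card G + card (mult q) + (\<Sum>d=2..M. card (mult (d\<^sup>2))))"
    by (simp only: of_nat_le_iff)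
  then have "real M \<le> real (card G) + real (card (mult q)) + (\<Sum>d=2..M. real (card (mult (d\<^sup>2))))"
    by simp
  moreover have "real (card (mult q)) \<le> real M / 8"
  proof -
    have "real (card (mult q)) \<le> real M / real q" using assms by (intro card_mult) auto
    also have "\<dots> \<le> real M / 8" using assms by (intro divide_left_mono) auto
    finally show ?thesis .
  qed
  moreover have "(\<Sum>d=2..M. real (card (mult (d\<^sup>2)))) \<le> 3 / 4 * real M"
  proof -
    have *: "(\<Sum>d=2..M. 1 / (real d)\<^sup>2) \<le> 3 / 4"
    proof (cases "M \<ge> 2")
      case True
      have "(\<Sum>d=2..M. 1 / (real d)\<^sup>2) \<le> 3 / 4 - 1 / real M" using True
      proof (induction M rule: nat_induct_at_least)
        case (Suc M)
        have "1 / (real (Suc M))\<^sup>2 \<le> 1 / (real M * real (Suc M))"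
          using Suc by (intro divide_left_mono) (auto simp: power2_eq_square)
        also have "\<dots> = 1 / real M - 1 / real (Suc M)" using Suc by (simp add: field_simps)
        finally show ?case using Suc by simp
      qed simp
      moreover have "0 \<le> 1 / real M" by simp
      ultimately show ?thesis by linarith
    qed simp
    have "(\<Sum>d=2..M. real (card (mult (d\<^sup>2)))) \<le> (\<Sum>d=2..M. real M * (1 / (real d)\<^sup>2))"
      using card_mult[of "d\<^sup>2" for d] by (intro sum_mono) simp
    also have "\<dots> = real M * (\<Sum>d=2..M. 1 / (real d)\<^sup>2)" by (rule sum_distrib_left[symmetric])
    also have "\<dots> \<le> real M * (3 / 4)" using * by (intro mult_left_mono) auto
    finally show ?thesis by simp
  qed
  ultimately show ?thesis unfolding G_def by linarith
qed


section \<open>Sets attaining the bound\<close>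

text \<open>
  Since \<open>q * q powr ((1 - \<beta>) / \<beta>) = q powr (1 / \<beta>)\<close>, these are the squarefree multiples of \<open>q\<close> up
  to \<open>N = q powr (1 / \<beta>)\<close>, the number for which \<open>q = N powr \<beta>\<close>.
\<close>
definition prime_block :: "real \<Rightarrow> nat \<Rightarrow> nat set" where
  "prime_block \<beta> q = (*) q ` {m \<in> {1..nat \<lfloor>real q powr ((1 - \<beta>) / \<beta>)\<rfloor>}. squarefree (q * m)}"

lemma finite_prime_block: "finite (prime_block \<beta> q)"
  by (simp add: prime_block_def)

text \<open>
  The count is at most \<open>y / q\<close> and at most \<open>q powr ((1 - \<beta>) / \<beta>)\<close>; in the weighted geometric mean of
  these two bounds with weights \<open>1 - \<beta>\<close> and \<open>\<beta>\<close>, the prime \<open>q\<close> cancels.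
\<close>
lemma card_prime_block_le:
  fixes y :: real
  assumes \<beta>: "0 < \<beta>" "\<beta> < 1" and "q > 0" "y \<ge> 0"
  shows "real (card {n \<in> prime_block \<beta> q. real n \<le> y}) \<le> y powr (1 - \<beta>)"
proof -
  define r where "r = (1 - \<beta>) / \<beta>"
  define K where "K = real (card {n \<in> prime_block \<beta> q. real n \<le> y})"
  have "{n \<in> prime_block \<beta> q. real n \<le> y} \<subseteq> (*) q ` {1..nat \<lfloor>min (y / real q) (real q powr r)\<rfloor>}"
  proof clarify
    fix n assume n: "n \<in> prime_block \<beta> q" "real n \<le> y"
    then obtain m where m: "n = q * m" "1 \<le> m" "m \<le> nat \<lfloor>real q powr r\<rfloor>"
      by (auto simp: prime_block_def r_def)
    have "real m \<le> y / real q" using m n \<open>q > 0\<close> by (simp add: field_simps)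
    moreover have "real m \<le> real q powr r" using m powr_ge_zero[of "real q" r] by linarith
    ultimately show "n \<in> (*) q ` {1..nat \<lfloor>min (y / real q) (real q powr r)\<rfloor>}"
      using m by (auto simp: le_nat_floor)
  qed
  then have "card {n \<in> prime_block \<beta> q. real n \<le> y} \<le> card {1..nat \<lfloor>min (y / real q) (real q powr r)\<rfloor>}"
    by (meson card_image_le card_mono finite_atLeastAtMost finite_imageI le_trans)
  then have "K \<le> real (nat \<lfloor>min (y / real q) (real q powr r)\<rfloor>)" by (simp add: K_def)
  also have "\<dots> \<le> min (y / real q) (real q powr r)" using assms by (intro of_nat_floor) simp
  finally have K: "K \<le> y / real q" "K \<le> real q powr r" by simp_all
  have "K = K powr (1 - \<beta>) * K powr \<beta>"
    by (cases "K = 0") (simp_all add: K_def flip: powr_add)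
  also have "\<dots> \<le> (y / real q) powr (1 - \<beta>) * (real q powr r) powr \<beta>"
    using K \<beta> by (intro mult_mono powr_mono2) (auto simp: K_def)
  also have "\<dots> = y powr (1 - \<beta>)"
    using assms by (simp add: powr_divide powr_powr r_def)
  finally show ?thesis by (simp add: K_def)
qed

text \<open>
  The constant \<open>1 / 16\<close> is the density \<open>1 / 8\<close> times a factor \<open>1 / 2\<close> for rounding down.
\<close>
lemma card_prime_block_ge:
  assumes \<beta>: "0 < \<beta>" "\<beta> < 1" and q: "prime q" "q \<ge> 8"
  shows "real q powr ((1 - \<beta>) / \<beta>) / 16 \<le> real (card (prime_block \<beta> q))"
proof -
  define R where "R = real q powr ((1 - \<beta>) / \<beta>)"
  have "R \<ge> 1" unfolding R_def using assms by (intro ge_one_powr_ge_zero) auto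
  then have "1 \<le> \<lfloor>R\<rfloor>" by simp
  then have "real (nat \<lfloor>R\<rfloor>) = of_int \<lfloor>R\<rfloor>" "1 \<le> real_of_int \<lfloor>R\<rfloor>" by simp_all
  then have "R / 2 \<le> real (nat \<lfloor>R\<rfloor>)" by linarith
  also have "\<dots> / 8 \<le> real (card {m \<in> {1..nat \<lfloor>R\<rfloor>}. squarefree (q * m)})"
    using q by (rule card_squarefree_prime_multiples_ge)
  also have "card {m \<in> {1..nat \<lfloor>R\<rfloor>}. squarefree (q * m)} = card (prime_block \<beta> q)"
    unfolding prime_block_def R_def using q
    by (intro card_image[symmetric]) (auto simp: inj_on_def)
  finally show ?thesis by (simp add: R_def)
qed

lemma lcm_prime_block_le:
  assumes "n \<in> prime_block \<beta> q" "n' \<in> prime_block \<beta> q"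
  shows "real (lcm n n') \<le> real q powr (1 + 2 * ((1 - \<beta>) / \<beta>))"
proof -
  define R where "R = real q powr ((1 - \<beta>) / \<beta>)"
  have "R \<ge> 0" by (simp add: R_def)
  from assms obtain m m' where m: "n = q * m" "n' = q * m'" "m > 0" "m' > 0"
    "m \<le> nat \<lfloor>R\<rfloor>" "m' \<le> nat \<lfloor>R\<rfloor>" "squarefree (q * m)"
    by (auto simp: prime_block_def R_def)
  have "q > 0" using m(7) by (cases "q = 0") auto
  have "real m \<le> R" "real m' \<le> R" using m \<open>R \<ge> 0\<close> by linarith+
  have "lcm n n' dvd q * (m * m')" using m by (auto intro!: lcm_least)
  then have "lcm n n' \<le> q * (m * m')" using m \<open>q > 0\<close> by (intro dvd_imp_le) auto
  then have "real (lcm n n') \<le> real (q * (m * m'))" by (simp only: of_nat_le_iff)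
  also have "\<dots> = real q * (real m * real m')" by simp
  also have "\<dots> \<le> real q * (R * R)"
    using \<open>real m \<le> R\<close> \<open>real m' \<le> R\<close> by (intro mult_left_mono mult_mono) auto
  also have "\<dots> = real q powr 1 * (R * R)" using \<open>q > 0\<close> by simp
  also have "\<dots> = real q powr (1 + 2 * ((1 - \<beta>) / \<beta>))"
    unfolding R_def by (simp only: powr_add[symmetric]) simp
  finally show ?thesis .
qed

text \<open>
  All elements of a block are at least its prime, so only the blocks with \<open>2 ^ k \<le> y\<close> contribute to
  the count up to \<open>y\<close>; there are at most \<open>1 + log 2 y\<close> of them, which is absorbed by the \<open>o(1)\<close> in the exponent.
\<close>
lemma polynomially_sparse_Union_prime_blocks:
  fixes q :: "nat \<Rightarrow> nat"
  assumes \<beta>: "0 < \<beta>" "\<beta> < 1" and q: "\<And>k. 2 ^ k < q k"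
  shows "polynomially_sparse \<beta> (\<Union>k. prime_block \<beta> (q k))"
proof -
  let ?S = "\<Union>k. prime_block \<beta> (q k)"
  have q_pos: "q k > 0" for k using q[of k] by simp
  have count: "real (card {n \<in> ?S. real n \<le> y}) \<le> (1 + log 2 y) * y powr (1 - \<beta>)" if "y \<ge> 1" for y
  proof -
    define L where "L = nat \<lfloor>log 2 y\<rfloor>"
    have "{n \<in> ?S. real n \<le> y} \<subseteq> (\<Union>k\<le>L. {n \<in> prime_block \<beta> (q k). real n \<le> y})"
    proof clarify
      fix n k assume n: "n \<in> prime_block \<beta> (q k)" "real n \<le> y"
      then have "q k \<le> n" by (auto simp: prime_block_def)
      with q[of k] have "2 ^ k \<le> n" by simp
      then have "real (2 ^ k) \<le> real n" by (simp only: of_nat_le_iff)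
      then have "real (2 ^ k) \<le> y" using n(2) by (rule order_trans)
      then have "2 powr real k \<le> y" by (simp add: powr_realpow)
      with that have "real k \<le> log 2 y" by (simp add: le_log_iff)
      then have "k \<le> L" by (simp add: L_def le_nat_floor)
      with n show "n \<in> (\<Union>k\<le>L. {n \<in> prime_block \<beta> (q k). real n \<le> y})" by auto
    qed
    then have "card {n \<in> ?S. real n \<le> y} \<le> card (\<Union>k\<le>L. {n \<in> prime_block \<beta> (q k). real n \<le> y})"
      by (intro card_mono) (auto simp: finite_prime_block)
    also have "\<dots> \<le> (\<Sum>k\<le>L. card {n \<in> prime_block \<beta> (q k). real n \<le> y})"
      by (rule card_UN_le) simp
    finally have "real (card {n \<in> ?S. real n \<le> y})
        \<le> (\<Sum>k\<le>L. real (card {n \<in> prime_block \<beta> (q k). real n \<le> y}))"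
      by (simp flip: of_nat_sum)
    also have "\<dots> \<le> (\<Sum>k\<le>L. y powr (1 - \<beta>))"
      using \<beta> q_pos that by (intro sum_mono card_prime_block_le) auto
    also have "\<dots> = (1 + real L) * y powr (1 - \<beta>)" by simp
    also have "\<dots> \<le> (1 + log 2 y) * y powr (1 - \<beta>)"
      using that by (intro mult_right_mono) (auto simp: L_def)
    finally show ?thesis .
  qed
  have "le_powr_o1 (\<lambda>x. real (card {n \<in> ?S. real n \<le> x})) (1 - \<beta>)"
    unfolding le_powr_o1_iff
  proof (intro allI impI)
    fix \<epsilon> :: real assume "\<epsilon> > 0"
    then have "\<forall>\<^sub>F y::real in at_top. 1 + log 2 y \<le> y powr \<epsilon>" by real_asymp
    then show "\<forall>\<^sub>F y in at_top. real (card {n \<in> ?S. real n \<le> y}) \<le> y powr (1 - \<beta> + \<epsilon>)"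
      using eventually_ge_at_top[of 1]
    proof eventually_elim
      case (elim y)
      have "real (card {n \<in> ?S. real n \<le> y}) \<le> (1 + log 2 y) * y powr (1 - \<beta>)"
        using elim by (intro count) auto
      also have "\<dots> \<le> y powr \<epsilon> * y powr (1 - \<beta>)" using elim by (intro mult_right_mono) auto
      also have "\<dots> = y powr (1 - \<beta> + \<epsilon>)" by (simp add: add_ac flip: powr_add)
      finally show ?case .
    qed
  qed
  moreover have "n > 0 \<and> squarefree n" if "n \<in> ?S" for n
    using that q_pos by (auto simp: prime_block_def)
  ultimately show ?thesis unfolding polynomially_sparse_def by blast
qed

text \<open>
  All pairs from one block have lcm at most \<open>x\<close>, and with \<open>r = (1 - \<beta>) / \<beta>\<close> the square
  \<open>q powr (2 * r)\<close> is exactly \<open>x powr (1 - \<beta> / (2 - \<beta>))\<close>.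
\<close>
lemma lcm_pair_count_ge_prime_block:
  assumes \<beta>: "0 < \<beta>" "\<beta> < 1" and q: "prime q" "q \<ge> 8"
    and S: "0 \<notin> S" "prime_block \<beta> q \<subseteq> S"
    and x: "x = real q powr (1 + 2 * ((1 - \<beta>) / \<beta>))"
  shows "x powr (1 - \<beta> / (2 - \<beta>)) / 256 \<le> lcm_pair_count S x"
proof -
  let ?B = "prime_block \<beta> q"
  define R where "R = real q powr ((1 - \<beta>) / \<beta>)"
  have "(1 + 2 * ((1 - \<beta>) / \<beta>)) * (1 - \<beta> / (2 - \<beta>)) = (1 - \<beta>) / \<beta> + (1 - \<beta>) / \<beta>"
    using \<beta> by (simp add: divide_simps)
  then have "x powr (1 - \<beta> / (2 - \<beta>)) / 256 = (R / 16) * (R / 16)"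
    by (simp add: x R_def powr_powr flip: powr_add)
  also have "\<dots> \<le> real (card ?B) * real (card ?B)"
    using card_prime_block_ge[OF \<beta> q] by (intro mult_mono) (auto simp: R_def)
  also have "\<dots> = real (card (?B \<times> ?B))" by (simp add: card_cartesian_product)
  also have "\<dots> \<le> lcm_pair_count S x"
    unfolding lcm_pair_count_def of_nat_le_iff
  proof (rule card_mono[OF finite_lcm_pairs[OF S(1)]])
    show "?B \<times> ?B \<subseteq> {(n, n'). n \<in> S \<and> n' \<in> S \<and> real (lcm n n') \<le> x}"
      using S(2) lcm_prime_block_le[of _ \<beta> q] by (auto simp: x)
  qed
  finally show ?thesis .
qed

lemma lcm_pair_count_tight:
  fixes \<beta> :: real
  assumes \<beta>: "0 < \<beta>" "\<beta> < 1"
  shows "\<exists>S. polynomially_sparse \<beta> S \<and>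
           \<not> (\<exists>\<delta>>0. le_powr_o1 (lcm_pair_count S) (1 - \<beta> / (2 - \<beta>) - \<delta>))"
proof -
  have "\<exists>p. prime p \<and> p > (2::nat) ^ k + 8" for k :: nat
    using bigger_prime by blast
  then obtain q :: "nat \<Rightarrow> nat" where q: "\<And>k. prime (q k)" "\<And>k. q k > 2 ^ k + 8" by metis
  have q2: "2 ^ k < q k" "8 \<le> q k" for k using q(2)[of k] by linarith+
  define S where "S = (\<Union>k. prime_block \<beta> (q k))"
  define c where "c = 1 - \<beta> / (2 - \<beta>)"
  have sparse: "polynomially_sparse \<beta> S"
    unfolding S_def using \<beta> q2 by (intro polynomially_sparse_Union_prime_blocks)
  then have zero: "0 \<notin> S" by (auto simp: polynomially_sparse_def)
  have "\<not> le_powr_o1 (lcm_pair_count S) (c - \<delta>)" if "\<delta> > 0" for \<delta>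
  proof
    assume "le_powr_o1 (lcm_pair_count S) (c - \<delta>)"
    then have "\<forall>\<^sub>F x in at_top. lcm_pair_count S x \<le> x powr (c - \<delta> + \<delta> / 2)"
      using that unfolding le_powr_o1_iff by (meson half_gt_zero)
    moreover have "\<forall>\<^sub>F x::real in at_top. x powr (\<delta> / 2) > 256" using that by real_asymp
    ultimately have "\<forall>\<^sub>F x in at_top. lcm_pair_count S x < x powr c / 256"
      using eventually_gt_at_top[of 0]
    proof eventually_elim
      case (elim x)
      have "x powr (c - \<delta> + \<delta> / 2) * 256 < x powr (c - \<delta> + \<delta> / 2) * x powr (\<delta> / 2)"
        using elim by (intro mult_strict_left_mono) auto
      also have "\<dots> = x powr c" by (simp flip: powr_add)
      finally show ?case using elim by simp
    qed
    then obtain X where X: "\<And>x. x \<ge> X \<Longrightarrow> lcm_pair_count S x < x powr c / 256"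
      by (auto simp: eventually_at_top_linorder)
    \<comment> \<open>The bound is contradicted at the scale of any block far enough out.\<close>
    obtain k :: nat where k: "X \<le> real k" using real_arch_simple by blast
    define x where "x = real (q k) powr (1 + 2 * ((1 - \<beta>) / \<beta>))"
    have "k < q k" using less_exp[of k] q2(1)[of k] by linarith
    then have "X \<le> real (q k) powr 1" using k by simp
    also have "\<dots> \<le> x" unfolding x_def using \<beta> q2(2)[of k] by (intro powr_mono) auto
    finally have "lcm_pair_count S x < x powr c / 256" by (rule X)
    moreover have "x powr c / 256 \<le> lcm_pair_count S x"
      unfolding c_def using \<beta> q(1) q2(2) zero
      by (intro lcm_pair_count_ge_prime_block[OF _ _ _ _ _ _ x_def]) (auto simp: S_def)
    ultimately show False by linarith
  qed
  with sparse show ?thesis by (auto simp: c_def)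
qed

theorem theoremC:
  fixes \<beta> :: real
  assumes "0 < \<beta>" and "\<beta> < 1"
  shows "(\<forall>S. polynomially_sparse \<beta> S \<longrightarrow>
            le_powr_o1 (lcm_pair_count S) (1 - \<beta> / (2 - \<beta>))) \<and>
         (\<exists>S. polynomially_sparse \<beta> S \<and>
            \<not> (\<exists>\<delta>>0. le_powr_o1 (lcm_pair_count S) (1 - \<beta> / (2 - \<beta>) - \<delta>)))"
  using lcm_pair_count_upper[OF assms] lcm_pair_count_tight[OF assms] by blast

end
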